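(* Let $a<b$ be real numbers, let $1<p<\infty$, and let $q$ satisfy $\frac1p+\frac1q=1$. Let $f:[a,b]\times\mathbb{R}\to\mathbb{R}$ satisfy the Carathéodory conditions, let $k:[a,b]\times[a,b]\to\mathbb{R}$, and let $g$ be a function on $[a,b]\times\mathbb{R}$. Assume: (A1) There are a non-negative function $h_1\in L^p([a,b])$ and a constant $b_1\ge 0$ such that $|f(t,x)|\le h_1(t)+b_1|x|^{q/p}$ for a.e. $t\in[a,b]$ and all $x\in\mathbb{R}$. (A2) For all $t\in[a,b]$, $k(t,\cdot)$ is measurable and belongs to $L^q([a,b])$, and $\left(\int_a^b|k(t,s)|^q\,ds\right)^{1/q}\le M_1(t)$ for any $t\in[a,b]$, where $M_1$ is a non-negative function in $L^p([a,b])$. (A3) $g$ is a map from $[a,b]\times\mathbb{R}$ into $[a,b]$ satisfying the Carathéodory conditions and such that $|g(s,z)|\le a_0(s)+b_0|z|$ for $s\in[a,b]$, $z\in\mathbb{R}$, where $a_0$ is a non-negative function in $L^p([a,b])$ and $b_0\ge0$ is a constant. (H1) There is $M>0$ such that $|f(t,x_1)-f(t,x_2)|\le M|x_1-x_2|$ for any $t\in[a,b]$ and $x_1,x_2\in\mathbb{R}$. (H2) There is $L>0$ such that $|g(s,z_1)-g(s,z_2)|\le L|z_1-z_2|$ for any $s\in[a,b]$ and $z_1,z_2\in\mathbb{R}$. Put $C=ML$. Define the successive approximations by $y_0(t)=0$ and $$y_{n+1}(t)=f\left(t,\int_a^b k(t,s)\,g(s,y_n(s))\,ds\right),\qquad n=0,1,2,\dots$$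 Then $(y_n)$ converges almost everywhere on $[a,b]$ to the exact solution of the equation $$y(t)=f\left(t,\int_a^b k(t,s)\,g(s,y(s))\,ds\right),\qquad t\in[a,b],$$ provided $$N^p:=\int_a^b C^p[M_1(s)]^p\,ds<1.$$
   Context: A function $\varphi:[a,b]\times\mathbb{R}\to\mathbb{R}$ satisfies the Carathéodory conditions if: (i) $\varphi(t,x)$ is continuous in $x$ for each fixed $t$; (ii) $\varphi(t,x)$ is measurable in $t$ for each fixed $x$; (iii) there is a non-negative Lebesgue-integrable function $m:[a,b]\to\mathbb{R}$ such that $|\varphi(t,x)|\le m(t)$ for all $(t,x)\in[a,b]\times\mathbb{R}$. Functions are real-valued and $L^p([a,b])$ is taken with respect to Lebesgue measure. Solutions of the integral equation are sought in $L^p([a,b])$, i.e. a solution is a $y\in L^p([a,b])$ satisfying the equation (as an identity of elements of $L^p([a,b])$).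
   Formalization: The kernel k is additionally assumed jointly Lebesgue measurable on [a,b]×[a,b]; with only the sections k(t,·) measurable the claim fails, e.g. k(t,s)=ε·1_A(t) with A non-measurable, g=1, where no solution lies in L^p. *)

theory Defs
  imports "HOL-Analysis.Analysis"
begin

text \<open>
  Functions on \<open>[a,b]\<close> are total functions of which only the values on \<open>{a..b}\<close> matter.
  Elements of \<open>L\<^sup>p([a,b])\<close> are represented by functions; equality in \<open>L\<^sup>p\<close> is equality
  almost everywhere with respect to \<^term>\<open>lebesgue_on {a..b}\<close>.
\<close>

definition Lp_space :: "real \<Rightarrow> real \<Rightarrow> real \<Rightarrow> (real \<Rightarrow> real) set" where
  "Lp_space p a b =
     {u \<in> borel_measurable (lebesgue_on {a..b}).
        integrable (lebesgue_on {a..b}) (\<lambda>t. \<bar>u t\<bar> powr p)}"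

definition caratheodory :: "real \<Rightarrow> real \<Rightarrow> (real \<Rightarrow> real \<Rightarrow> real) \<Rightarrow> bool" where
  "caratheodory a b \<phi> \<longleftrightarrow>
     (\<forall>t\<in>{a..b}. continuous_on UNIV (\<lambda>x. \<phi> t x)) \<and>
     (\<forall>x. (\<lambda>t. \<phi> t x) \<in> borel_measurable (lebesgue_on {a..b})) \<and>
     (\<exists>m. integrable (lebesgue_on {a..b}) m \<and> (\<forall>t\<in>{a..b}. 0 \<le> m t) \<and>
          (\<forall>t\<in>{a..b}. \<forall>x. \<bar>\<phi> t x\<bar> \<le> m t))"

definition rhs_operator ::
  "real \<Rightarrow> real \<Rightarrow> (real \<Rightarrow> real \<Rightarrow> real) \<Rightarrow> (real \<Rightarrow> real \<Rightarrow> real) \<Rightarrow>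
   (real \<Rightarrow> real \<Rightarrow> real) \<Rightarrow> (real \<Rightarrow> real) \<Rightarrow> real \<Rightarrow> real" where
  "rhs_operator a b f k g y t =
     f t (LINT s|lebesgue_on {a..b}. k t s * g s (y s))"

text \<open>
  The equation is an identity between elements of \<open>L\<^sup>p([a,b])\<close>, hence required for almost
  every \<open>t\<close> only.
\<close>

definition is_solution ::
  "real \<Rightarrow> real \<Rightarrow> real \<Rightarrow> (real \<Rightarrow> real \<Rightarrow> real) \<Rightarrow> (real \<Rightarrow> real \<Rightarrow> real) \<Rightarrow>
   (real \<Rightarrow> real \<Rightarrow> real) \<Rightarrow> (real \<Rightarrow> real) \<Rightarrow> bool" where
  "is_solution p a b f k g y \<longleftrightarrow>
     y \<in> Lp_space p a b \<and>
     (AE t in lebesgue_on {a..b}. y t = rhs_operator a b f k g y t)"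

end

theory Submission
  imports Defs
begin

text \<open>
  Write \<open>T u (t) = f(t, \<integral> k(t,s) g(s, u(s)) ds)\<close>. The theorem is the contraction principle for \<open>T\<close>
  on \<open>L\<^sup>p([a,b])\<close>, in a form that yields convergence at every point rather than convergence in norm.

  The key is the pointwise estimate \<open>T_diff_pointwise\<close>:
  \<open>\<bar>T u (t) - T v (t)\<bar> \<le> C M\<^sub>1(t) \<parallel>u - v\<parallel>\<^sub>p\<close>. It follows from the Lipschitz bounds on \<open>f\<close> and \<open>g\<close>
  and Hoelder's inequality, the \<open>L\<^sup>q\<close> norm of \<open>k(t,\<cdot>)\<close> being at most \<open>M\<^sub>1(t)\<close>. Taking \<open>L\<^sup>p\<close> norms in
  \<open>t\<close> shows that \<open>T\<close> contracts distances by \<open>N = \<parallel>C M\<^sub>1\<parallel>\<^sub>p < 1\<close>, hence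
  \<open>\<parallel>y\<^sub>n\<^sub>+\<^sub>1 - y\<^sub>n\<parallel>\<^sub>p \<le> N\<^sup>n \<parallel>y\<^sub>1 - y\<^sub>0\<parallel>\<^sub>p\<close>. Feeding this back into the pointwise estimate gives
  \<open>\<bar>y\<^sub>n\<^sub>+\<^sub>2(t) - y\<^sub>n\<^sub>+\<^sub>1(t)\<bar> \<le> C M\<^sub>1(t) N\<^sup>n \<parallel>y\<^sub>1 - y\<^sub>0\<parallel>\<^sub>p\<close>, so the sequence converges for each \<open>t\<close> by
  comparison with a geometric series (\<open>iterates_convergent\<close>).

  The limit \<open>u\<close> is measurable. Since \<open>g\<close> is bounded, dominated convergence under the integral and
  continuity of \<open>f(t,\<cdot>)\<close> give \<open>u = T u\<close> (\<open>limit_is_fixed_point\<close>), and \<open>u\<close> lies in \<open>L\<^sup>p\<close>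
  because \<open>T\<close> maps every measurable function into \<open>L\<^sup>p\<close> (\<open>T_in_Lp\<close>). Two solutions are at
  \<open>L\<^sup>p\<close> distance \<open>d \<le> N d\<close>, so \<open>d = 0\<close> and they agree almost everywhere (\<open>solution_unique\<close>).

  That \<open>T u\<close> is measurable at all rests on two facts: a Caratheodory function composed with a measurable
  function is measurable (\<open>caratheodory_superposition_measurable\<close>), and the integral of a Lebesgue
  measurable kernel against a measurable function is measurable in the parameter
  (\<open>kernel_integral_measurable\<close>).
\<close>

section \<open>Hoelder's inequality\<close>

lemma conjugate_exponent_gt_1:
  fixes p q :: real
  assumes "1 < p" "1 / p + 1 / q = 1"
  shows "1 < q"
proof -
  have "1 / q = 1 - 1 / p" "0 < 1 / p" "1 / p < 1"
    using assms by (auto simp: field_simps)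
  then have "0 < 1 / q" "1 / q < 1" by linarith+
  then show ?thesis
    by (simp add: divide_less_eq_1 split: if_splits)
qed

lemma Hoelder_integrable:
  fixes u v :: "'a \<Rightarrow> real"
  assumes p: "1 < p" and pq: "1 / p + 1 / q = 1"
    and [measurable]: "u \<in> borel_measurable M" "v \<in> borel_measurable M"
    and u: "integrable M (\<lambda>x. \<bar>u x\<bar> powr p)" and v: "integrable M (\<lambda>x. \<bar>v x\<bar> powr q)"
  shows "integrable M (\<lambda>x. u x * v x)"
proof (rule Bochner_Integration.integrable_bound)
  show "integrable M (\<lambda>x. \<bar>u x\<bar> powr p / p + \<bar>v x\<bar> powr q / q)"
    using u v by auto
  show "AE x in M. norm (u x * v x) \<le> norm (\<bar>u x\<bar> powr p / p + \<bar>v x\<bar> powr q / q)"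
  proof (rule AE_I2)
    fix x
    have "norm (u x * v x) = \<bar>u x\<bar> * \<bar>v x\<bar>"
      by (simp add: abs_mult)
    also have "\<dots> \<le> \<bar>u x\<bar> powr p / p + \<bar>v x\<bar> powr q / q"
      by (rule Youngs_inequality[OF p conjugate_exponent_gt_1[OF p pq] pq]) auto
    finally show "norm (u x * v x) \<le> norm (\<bar>u x\<bar> powr p / p + \<bar>v x\<bar> powr q / q)"
      by (rule order_trans) simp
  qed
qed measurable

text \<open>
  Young's inequality applied to \<open>\<bar>u\<bar> / \<parallel>u\<parallel>\<^sub>p\<close> and \<open>\<bar>v\<bar> / \<parallel>v\<parallel>\<^sub>q\<close> and integrated; after this
  normalisation the right-hand side integrates to \<open>1 / p + 1 / q = 1\<close>. If one of the norms is zero, the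
  normalisation fails, but then \<open>u v\<close> vanishes almost everywhere.
\<close>

lemma Hoelder_inequality:
  fixes u v :: "'a \<Rightarrow> real"
  assumes p: "1 < p" and pq: "1 / p + 1 / q = 1"
    and [measurable]: "u \<in> borel_measurable M" "v \<in> borel_measurable M"
    and u: "integrable M (\<lambda>x. \<bar>u x\<bar> powr p)" and v: "integrable M (\<lambda>x. \<bar>v x\<bar> powr q)"
  shows "\<bar>LINT x|M. u x * v x\<bar>
    \<le> (LINT x|M. \<bar>u x\<bar> powr p) powr (1 / p) * (LINT x|M. \<bar>v x\<bar> powr q) powr (1 / q)"
proof -
  define A where "A = (LINT x|M. \<bar>u x\<bar> powr p)"
  define B where "B = (LINT x|M. \<bar>v x\<bar> powr q)"
  have q: "1 < q" using conjugate_exponent_gt_1[OF p pq] .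
  have "A \<ge> 0" "B \<ge> 0" by (auto simp: A_def B_def)
  show ?thesis
  proof (cases "A = 0 \<or> B = 0")
    case True
    have "AE x in M. u x * v x = 0"
    proof (cases "A = 0")
      case True
      then have "AE x in M. \<bar>u x\<bar> powr p = 0"
        using integral_nonneg_eq_0_iff_AE[OF u] by (simp add: A_def)
      then show ?thesis by eventually_elim simp
    next
      case False
      then have "AE x in M. \<bar>v x\<bar> powr q = 0"
        using True integral_nonneg_eq_0_iff_AE[OF v] by (simp add: B_def)
      then show ?thesis by eventually_elim simp
    qed
    then have "(LINT x|M. u x * v x) = 0"
      by (rule integral_eq_zero_AE)
    then show ?thesis by simp
  next
    case False
    then have A: "A > 0" and B: "B > 0" using \<open>A \<ge> 0\<close> \<open>B \<ge> 0\<close> by auto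
    define \<alpha> where "\<alpha> = A powr (1 / p)"
    define \<beta> where "\<beta> = B powr (1 / q)"
    have \<alpha>: "\<alpha> > 0" "\<alpha> powr p = A" and \<beta>: "\<beta> > 0" "\<beta> powr q = B"
      using A B p q by (auto simp: \<alpha>_def \<beta>_def powr_powr)
    have "\<bar>LINT x|M. u x * v x\<bar> \<le> (LINT x|M. \<bar>u x * v x\<bar>)"
      using integral_norm_bound[of M "\<lambda>x. u x * v x"] by simp
    also have "\<dots> \<le> (LINT x|M. \<alpha> * \<beta> * (\<bar>u x\<bar> powr p / (A * p) + \<bar>v x\<bar> powr q / (B * q)))"
    proof (rule integral_mono)
      show "integrable M (\<lambda>x. \<bar>u x * v x\<bar>)"
        using Hoelder_integrable[OF assms] by (rule integrable_abs)
      show "integrable M (\<lambda>x. \<alpha> * \<beta> * (\<bar>u x\<bar> powr p / (A * p) + \<bar>v x\<bar> powr q / (B * q)))"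
        using u v by auto
      fix x
      have "\<bar>u x\<bar> / \<alpha> * (\<bar>v x\<bar> / \<beta>) \<le> (\<bar>u x\<bar> / \<alpha>) powr p / p + (\<bar>v x\<bar> / \<beta>) powr q / q"
        using \<alpha> \<beta> by (intro Youngs_inequality p q pq) auto
      also have "\<dots> = \<bar>u x\<bar> powr p / (A * p) + \<bar>v x\<bar> powr q / (B * q)"
        using \<alpha> \<beta> by (simp add: powr_divide)
      finally have "\<alpha> * \<beta> * (\<bar>u x\<bar> / \<alpha> * (\<bar>v x\<bar> / \<beta>))
          \<le> \<alpha> * \<beta> * (\<bar>u x\<bar> powr p / (A * p) + \<bar>v x\<bar> powr q / (B * q))"
        using \<alpha> \<beta> by (intro mult_left_mono) auto
      then show "\<bar>u x * v x\<bar> \<le> \<alpha> * \<beta> * (\<bar>u x\<bar> powr p / (A * p) + \<bar>v x\<bar> powr q / (B * q))"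
        using \<alpha> \<beta> by (simp add: abs_mult)
    qed
    also have "\<dots> = \<alpha> * \<beta> * (A / (A * p) + B / (B * q))"
      using u v by (simp add: A_def B_def)
    also have "\<dots> = \<alpha> * \<beta>"
      using A B pq by simp
    finally show ?thesis by (simp add: \<alpha>_def \<beta>_def A_def B_def)
  qed
qed

section \<open>The spaces \<open>L\<^sup>p([a,b])\<close>\<close>

definition Lp_norm :: "real \<Rightarrow> real \<Rightarrow> real \<Rightarrow> (real \<Rightarrow> real) \<Rightarrow> real" where
  "Lp_norm p a b u = (LINT t|lebesgue_on {a..b}. \<bar>u t\<bar> powr p) powr (1 / p)"

lemma Lp_norm_nonneg: "0 \<le> Lp_norm p a b u"
  by (simp add: Lp_norm_def)

lemma Lp_space_measurable: "u \<in> Lp_space p a b \<Longrightarrow> u \<in> borel_measurable (lebesgue_on {a..b})"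
  by (simp add: Lp_space_def)

lemma Lp_space_cong:
  assumes "\<And>t. t \<in> {a..b} \<Longrightarrow> u t = v t"
  shows "u \<in> Lp_space p a b \<longleftrightarrow> v \<in> Lp_space p a b"
proof -
  have "integrable (lebesgue_on {a..b}) (\<lambda>t. \<bar>u t\<bar> powr p)
      \<longleftrightarrow> integrable (lebesgue_on {a..b}) (\<lambda>t. \<bar>v t\<bar> powr p)"
    by (rule Bochner_Integration.integrable_cong) (simp_all add: assms)
  then show ?thesis
    using measurable_lebesgue_cong[of "{a..b}" u v borel, OF assms] by (simp add: Lp_space_def)
qed

lemma Lp_norm_cong:
  assumes "\<And>t. t \<in> {a..b} \<Longrightarrow> u t = v t"
  shows "Lp_norm p a b u = Lp_norm p a b v"
  using Bochner_Integration.integral_cong[of "lebesgue_on {a..b}" _ "\<lambda>t. \<bar>u t\<bar> powr p" "\<lambda>t. \<bar>v t\<bar> powr p"]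
  by (simp add: Lp_norm_def assms)

lemma Lp_norm_cmult:
  assumes "1 < p"
  shows "Lp_norm p a b (\<lambda>t. c * u t) = \<bar>c\<bar> * Lp_norm p a b u"
  using assms by (simp add: Lp_norm_def abs_mult powr_mult powr_powr)

lemma Lp_norm_eq_0_imp_AE:
  assumes "u \<in> Lp_space p a b" "Lp_norm p a b u = 0"
  shows "AE t in lebesgue_on {a..b}. u t = 0"
proof -
  have "AE t in lebesgue_on {a..b}. \<bar>u t\<bar> powr p = 0"
    using assms integral_nonneg_eq_0_iff_AE[of "lebesgue_on {a..b}" "\<lambda>t. \<bar>u t\<bar> powr p"]
    by (simp add: Lp_norm_def Lp_space_def)
  then show ?thesis by eventually_elim simp
qed

lemma Lp_space_dominated:
  assumes "1 < p" and [measurable]: "w \<in> borel_measurable (lebesgue_on {a..b})"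
    and v: "v \<in> Lp_space p a b" and le: "AE t in lebesgue_on {a..b}. \<bar>w t\<bar> \<le> \<bar>v t\<bar>"
  shows "w \<in> Lp_space p a b"
proof -
  have "integrable (lebesgue_on {a..b}) (\<lambda>t. \<bar>w t\<bar> powr p)"
  proof (rule Bochner_Integration.integrable_bound)
    show "AE t in lebesgue_on {a..b}. norm (\<bar>w t\<bar> powr p) \<le> norm (\<bar>v t\<bar> powr p)"
      using le by eventually_elim (use \<open>1 < p\<close> in \<open>auto intro: powr_mono2\<close>)
  qed (use v in \<open>auto simp: Lp_space_def\<close>)
  then show ?thesis by (simp add: Lp_space_def)
qed

lemma Lp_norm_mono_AE:
  assumes p: "1 < p" and w: "w \<in> borel_measurable (lebesgue_on {a..b})"
    and v: "v \<in> Lp_space p a b" and le: "AE t in lebesgue_on {a..b}. \<bar>w t\<bar> \<le> \<bar>v t\<bar>"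
  shows "Lp_norm p a b w \<le> Lp_norm p a b v"
proof -
  have "w \<in> Lp_space p a b" by (rule Lp_space_dominated[OF assms])
  moreover have "AE t in lebesgue_on {a..b}. \<bar>w t\<bar> powr p \<le> \<bar>v t\<bar> powr p"
    using le by eventually_elim (use p in \<open>auto intro: powr_mono2\<close>)
  ultimately have "(LINT t|lebesgue_on {a..b}. \<bar>w t\<bar> powr p)
      \<le> (LINT t|lebesgue_on {a..b}. \<bar>v t\<bar> powr p)"
    using v by (intro integral_mono_AE) (auto simp: Lp_space_def)
  then show ?thesis
    unfolding Lp_norm_def using p by (intro powr_mono2) auto
qed

lemma Lp_space_cmult:
  assumes "u \<in> Lp_space p a b"
  shows "(\<lambda>t. c * u t) \<in> Lp_space p a b"
  using assms by (auto simp: Lp_space_def abs_mult powr_mult)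

lemma Lp_space_abs:
  assumes "u \<in> Lp_space p a b"
  shows "(\<lambda>t. \<bar>u t\<bar>) \<in> Lp_space p a b"
  using assms by (auto simp: Lp_space_def)

lemma Lp_space_add:
  assumes p: "1 < p" and u: "u \<in> Lp_space p a b" and v: "v \<in> Lp_space p a b"
  shows "(\<lambda>t. u t + v t) \<in> Lp_space p a b"
proof -
  have [measurable]: "u \<in> borel_measurable (lebesgue_on {a..b})"
      "v \<in> borel_measurable (lebesgue_on {a..b})"
    using u v by (auto simp: Lp_space_def)
  have "integrable (lebesgue_on {a..b}) (\<lambda>t. \<bar>u t + v t\<bar> powr p)"
  proof (rule Bochner_Integration.integrable_bound)
    show "integrable (lebesgue_on {a..b}) (\<lambda>t. 2 powr p * (\<bar>u t\<bar> powr p + \<bar>v t\<bar> powr p))"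
      using u v by (auto simp: Lp_space_def)
    have "\<bar>x + y\<bar> powr p \<le> 2 powr p * (\<bar>x\<bar> powr p + \<bar>y\<bar> powr p)" for x y :: real
    proof -
      have "\<bar>x + y\<bar> powr p \<le> (2 * max \<bar>x\<bar> \<bar>y\<bar>) powr p"
        using p by (intro powr_mono2) auto
      also have "\<dots> = 2 powr p * max \<bar>x\<bar> \<bar>y\<bar> powr p"
        by (simp add: powr_mult)
      also have "\<dots> \<le> 2 powr p * (\<bar>x\<bar> powr p + \<bar>y\<bar> powr p)"
        by (intro mult_left_mono) (auto simp: max_def)
      finally show ?thesis .
    qed
    then show "AE t in lebesgue_on {a..b}. norm (\<bar>u t + v t\<bar> powr p)
        \<le> norm (2 powr p * (\<bar>u t\<bar> powr p + \<bar>v t\<bar> powr p))"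
      by (intro AE_I2) (simp add: abs_of_nonneg)
  qed measurable
  then show ?thesis by (simp add: Lp_space_def)
qed

lemma Lp_space_diff:
  assumes "1 < p" "u \<in> Lp_space p a b" "v \<in> Lp_space p a b"
  shows "(\<lambda>t. u t - v t) \<in> Lp_space p a b"
  using Lp_space_add[OF assms(1,2) Lp_space_cmult[OF assms(3), of "- 1"]] by simp

lemma Lp_space_bounded:
  assumes p: "1 < p" and u: "u \<in> borel_measurable (lebesgue_on {a..b})"
    and bound: "\<And>t. t \<in> {a..b} \<Longrightarrow> \<bar>u t\<bar> \<le> B"
  shows "u \<in> Lp_space p a b"
proof -
  interpret finite_measure "lebesgue_on {a..b}"
    by (rule finite_measure_lebesgue_on) simp
  have "(\<lambda>t. B) \<in> Lp_space p a b" by (simp add: Lp_space_def)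
  then show ?thesis
    by (rule Lp_space_dominated[OF p u])
      (use bound in \<open>auto intro!: AE_I2 intro: order.trans[OF _ abs_ge_self]\<close>)
qed

lemma Hoelder_Lp:
  assumes p: "1 < p" and pq: "1 / p + 1 / q = 1"
    and u: "u \<in> Lp_space p a b" and v: "v \<in> Lp_space q a b"
  shows "integrable (lebesgue_on {a..b}) (\<lambda>s. v s * u s)"
    and "\<bar>LINT s|lebesgue_on {a..b}. v s * u s\<bar> \<le> Lp_norm q a b v * Lp_norm p a b u"
  using Hoelder_integrable[OF p pq, of u "lebesgue_on {a..b}" v]
    Hoelder_inequality[OF p pq, of u "lebesgue_on {a..b}" v] u v
  by (auto simp: Lp_space_def Lp_norm_def mult.commute)

section \<open>Measurability\<close>

text \<open>
  Round \<open>u\<close> down to multiples of \<open>1 / (n + 1)\<close>. The rounded function takes countably many values, and on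
  each of the corresponding sets \<open>\<phi>\<close> has its second argument constant, so the composition is measurable;
  continuity of \<open>\<phi>(t,\<cdot>)\<close> carries this to the limit.
\<close>

lemma caratheodory_superposition_measurable:
  assumes \<phi>: "caratheodory a b \<phi>" and u [measurable]: "u \<in> borel_measurable (lebesgue_on {a..b})"
  shows "(\<lambda>t. \<phi> t (u t)) \<in> borel_measurable (lebesgue_on {a..b})"
proof (rule borel_measurable_LIMSEQ_real)
  define r where "r n x = real_of_int \<lfloor>real (Suc n) * x\<rfloor> / real (Suc n)" for n x
  show "(\<lambda>t. \<phi> t (r n (u t))) \<in> borel_measurable (lebesgue_on {a..b})" for n
    unfolding r_def
  proof (rule measurable_compose_countable[where f = "\<lambda>i t. \<phi> t (real_of_int i / real (Suc n))"
        and g = "\<lambda>t. \<lfloor>real (Suc n) * u t\<rfloor>"])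
    show "(\<lambda>t. \<phi> t (real_of_int i / real (Suc n))) \<in> borel_measurable (lebesgue_on {a..b})" for i
      using \<phi> by (simp add: caratheodory_def)
  qed measurable
  fix t assume t: "t \<in> space (lebesgue_on {a..b})"
  have "(\<lambda>n. r n (u t)) \<longlonglongrightarrow> u t"
  proof (rule tendsto_sandwich[OF _ _ LIMSEQ_inverse_real_of_nat_add_minus tendsto_const])
    have "u t - 1 / real (Suc n) \<le> r n (u t)" "r n (u t) \<le> u t" for n
    proof -
      have "real (Suc n) * u t - 1 \<le> real_of_int \<lfloor>real (Suc n) * u t\<rfloor>"
        "real_of_int \<lfloor>real (Suc n) * u t\<rfloor> \<le> real (Suc n) * u t"
        by linarith+
      then show "u t - 1 / real (Suc n) \<le> r n (u t)" "r n (u t) \<le> u t"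
        by (simp_all add: r_def divide_simps mult.commute del: of_nat_Suc)
    qed
    then show "\<forall>\<^sub>F n in sequentially. u t + - inverse (real (Suc n)) \<le> r n (u t)"
      "\<forall>\<^sub>F n in sequentially. r n (u t) \<le> u t"
      by (simp_all add: inverse_eq_divide)
  qed
  moreover have "isCont (\<phi> t) (u t)"
    using \<phi> t by (auto simp: caratheodory_def continuous_on_eq_continuous_at)
  ultimately show "(\<lambda>n. \<phi> t (r n (u t))) \<longlonglongrightarrow> \<phi> t (u t)"
    by (rule isCont_tendsto_compose[rotated])
qed

text \<open>
  Holds because Lebesgue measure is complete: the two preimages of a set differ by a subset of a null set.
\<close>

lemma borel_measurable_lebesgue_AE_cong:
  fixes f g :: "'a :: euclidean_space \<Rightarrow> real"
  assumes f: "f \<in> borel_measurable lebesgue" and eq: "AE x in lebesgue. f x = g x"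
  shows "g \<in> borel_measurable lebesgue"
proof (rule measurableI)
  fix A :: "real set" assume A: "A \<in> sets borel"
  have "AE x in lebesgue. x \<in> f -` A \<inter> space lebesgue \<longleftrightarrow> x \<in> g -` A \<inter> space lebesgue"
    using eq by eventually_elim simp
  then show "g -` A \<inter> space lebesgue \<in> sets lebesgue"
    by (rule completion.in_sets_AE) (use measurable_sets[OF f A] in auto)
qed simp

text \<open>
  Lebesgue measure on the plane is the completion of the product measure, so the Fubini theory of product
  measures does not apply to \<open>k\<close> itself. Replace \<open>k\<close> and \<open>w\<close> by Borel functions equal to them almost
  everywhere: for almost every \<open>t\<close> the slice of \<open>k\<close> agrees almost everywhere with that of its Borel version,
  so the parameter integral changes only on a null set of \<open>t\<close>. The slices \<open>k t\<close> have to be measurable for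
  the remaining integrals over \<open>s\<close> to be compared.
\<close>

lemma kernel_integral_measurable:
  fixes k :: "real \<Rightarrow> real \<Rightarrow> real" and w :: "real \<Rightarrow> real"
  assumes k: "(\<lambda>(t, s). k t s) \<in> borel_measurable lebesgue"
    and w: "w \<in> borel_measurable lebesgue"
    and kt: "\<And>t. k t \<in> borel_measurable lebesgue"
  shows "(\<lambda>t. LINT s|lebesgue. k t s * w s) \<in> borel_measurable lebesgue"
proof -
  obtain k' where k' [measurable]: "k' \<in> borel_measurable (lborel :: (real \<times> real) measure)"
    and eqk: "AE x in lborel. (\<lambda>(t, s). k t s) x = k' x"
    using completion_ex_borel_measurable_real[OF k] by blast
  obtain w' where w' [measurable]: "w' \<in> borel_measurable (lborel :: real measure)"
    and eqw: "AE s in lborel. w s = w' s"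
    using completion_ex_borel_measurable_real[OF w] by blast
  have k'' [measurable]: "k' \<in> borel_measurable (lborel \<Otimes>\<^sub>M lborel)"
    using k' by (simp add: lborel_prod)
  have "AE t in lborel. AE s in lborel. k t s = k' (t, s)"
    using lborel_pair.AE_pair[OF eqk[folded lborel_prod]] by simp
  then have eq: "AE t in lebesgue. AE s in lborel. k t s = k' (t, s)"
    by (rule AE_completion)
  have "(\<lambda>t. LINT s|lborel. k' (t, s) * w' s) \<in> borel_measurable lborel"
    by measurable
  then have "(\<lambda>t. LINT s|lborel. k' (t, s) * w' s) \<in> borel_measurable lebesgue"
    by (rule measurable_completion)
  moreover have "AE t in lebesgue. (LINT s|lborel. k' (t, s) * w' s) = (LINT s|lebesgue. k t s * w s)"
    using eq
  proof eventually_elim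
    case (elim t)
    have m [measurable]: "(\<lambda>s. k' (t, s) * w' s) \<in> borel_measurable lborel"
      by measurable
    have "(LINT s|lborel. k' (t, s) * w' s) = (LINT s|lebesgue. k' (t, s) * w' s)"
      by (rule integral_completion[OF m, symmetric])
    also have "\<dots> = (LINT s|lebesgue. k t s * w s)"
    proof (rule integral_cong_AE)
      show "(\<lambda>s. k' (t, s) * w' s) \<in> borel_measurable lebesgue"
        by (rule measurable_completion[OF m])
      show "(\<lambda>s. k t s * w s) \<in> borel_measurable lebesgue"
        using kt w by measurable
      have "AE s in lborel. k' (t, s) * w' s = k t s * w s"
        using elim eqw by eventually_elim simp
      then show "AE s in lebesgue. k' (t, s) * w' s = k t s * w s"
        by (rule AE_completion)
    qed
    finally show ?case .
  qed
  ultimately show ?thesis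
    by (rule borel_measurable_lebesgue_AE_cong)
qed

lemma kernel_integral_measurable_on:
  fixes k :: "real \<Rightarrow> real \<Rightarrow> real" and w :: "real \<Rightarrow> real"
  assumes k: "(\<lambda>(t, s). k t s) \<in> borel_measurable (lebesgue_on ({a..b} \<times> {a..b}))"
    and w: "w \<in> borel_measurable (lebesgue_on {a..b})"
    and kt: "\<And>t. t \<in> {a..b} \<Longrightarrow> k t \<in> borel_measurable (lebesgue_on {a..b})"
  shows "(\<lambda>t. LINT s|lebesgue_on {a..b}. k t s * w s) \<in> borel_measurable (lebesgue_on {a..b})"
proof -
  define k0 where "k0 t s = (if (t, s) \<in> {a..b} \<times> {a..b} then k t s else 0)" for t s
  define w0 where "w0 s = (if s \<in> {a..b} then w s else 0)" for s
  have sq: "{a..b} \<times> {a..b} \<in> sets (lebesgue :: (real \<times> real) measure)"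
    using lmeasurable_cbox[of "(a, a)" "(b, b)"] by (simp add: cbox_Pair_eq fmeasurableD)
  have "(\<lambda>(t, s). k0 t s) = (\<lambda>x. if x \<in> {a..b} \<times> {a..b} then (\<lambda>(t, s). k t s) x else 0)"
    by (auto simp: k0_def fun_eq_iff)
  then have "(\<lambda>(t, s). k0 t s) \<in> borel_measurable lebesgue"
    using borel_measurable_if_I[OF k sq] by simp
  moreover have "w0 \<in> borel_measurable lebesgue"
    unfolding w0_def by (rule borel_measurable_if_I[OF w]) simp
  moreover have "k0 t \<in> borel_measurable lebesgue" for t
  proof (cases "t \<in> {a..b}")
    case True
    then have "k0 t = (\<lambda>s. if s \<in> {a..b} then k t s else 0)"
      by (auto simp: k0_def)
    with borel_measurable_if_I[OF kt[OF True]] show ?thesis by simp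
  next
    case False
    then have "k0 t = (\<lambda>s. 0)" by (auto simp: k0_def)
    then show ?thesis by simp
  qed
  ultimately have "(\<lambda>t. LINT s|lebesgue. k0 t s * w0 s) \<in> borel_measurable lebesgue"
    by (rule kernel_integral_measurable)
  then have "(\<lambda>t. LINT s|lebesgue. k0 t s * w0 s) \<in> borel_measurable (lebesgue_on {a..b})"
    by (rule measurable_restrict_space1)
  moreover have "(LINT s|lebesgue. k0 t s * w0 s) = (LINT s|lebesgue_on {a..b}. k t s * w s)"
    if "t \<in> {a..b}" for t
    using that by (subst integral_restrict_space)
      (auto simp: k0_def w0_def indicator_def intro!: Bochner_Integration.integral_cong)
  ultimately show ?thesis
    by (subst measurable_lebesgue_cong[symmetric]) auto
qed

section \<open>The operator as a contraction\<close>

text \<open>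
  The data of the equation as the contraction argument sees them: \<open>f\<close> is controlled through
  \<open>f(\<cdot>,0) \<in> L\<^sup>p\<close> and its Lipschitz constant, and \<open>g\<close> takes values in a bounded set.
\<close>

locale Lipschitz_integral_equation =
  fixes a b p q B M L :: real
    and f k g :: "real \<Rightarrow> real \<Rightarrow> real"
    and M1 :: "real \<Rightarrow> real"
  assumes p: "1 < p"
    and pq: "1 / p + 1 / q = 1"
    and f_car: "caratheodory a b f"
    and f_0: "(\<lambda>t. f t 0) \<in> Lp_space p a b"
    and f_Lipschitz: "\<And>t x1 x2. t \<in> {a..b} \<Longrightarrow> \<bar>f t x1 - f t x2\<bar> \<le> M * \<bar>x1 - x2\<bar>"
    and M_nonneg: "0 \<le> M"
    and k_meas: "(\<lambda>(t, s). k t s) \<in> borel_measurable (lebesgue_on ({a..b} \<times> {a..b}))"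
    and k_Lq: "\<And>t. t \<in> {a..b} \<Longrightarrow> k t \<in> Lp_space q a b"
    and k_norm: "\<And>t. t \<in> {a..b} \<Longrightarrow> Lp_norm q a b (k t) \<le> M1 t"
    and M1_Lp: "M1 \<in> Lp_space p a b"
    and g_car: "caratheodory a b g"
    and g_bounded: "\<And>s z. s \<in> {a..b} \<Longrightarrow> \<bar>g s z\<bar> \<le> B"
    and g_Lipschitz: "\<And>s z1 z2. s \<in> {a..b} \<Longrightarrow> \<bar>g s z1 - g s z2\<bar> \<le> L * \<bar>z1 - z2\<bar>"
    and L_nonneg: "0 \<le> L"
begin

abbreviation T :: "(real \<Rightarrow> real) \<Rightarrow> real \<Rightarrow> real" where
  "T \<equiv> rhs_operator a b f k g"

definition kernel_term :: "(real \<Rightarrow> real) \<Rightarrow> real \<Rightarrow> real" where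
  "kernel_term u t = (LINT s|lebesgue_on {a..b}. k t s * g s (u s))"

definition contraction_factor :: real where
  "contraction_factor = Lp_norm p a b (\<lambda>t. M * L * M1 t)"

lemma T_eq: "T u t = f t (kernel_term u t)"
  by (simp add: rhs_operator_def kernel_term_def)

lemma M1_nonneg: "t \<in> {a..b} \<Longrightarrow> 0 \<le> M1 t"
  using k_norm[of t] Lp_norm_nonneg[of q a b "k t"] by linarith

lemma g_superposition_Lp:
  assumes "u \<in> borel_measurable (lebesgue_on {a..b})"
  shows "(\<lambda>s. g s (u s)) \<in> Lp_space p a b"
  by (rule Lp_space_bounded[OF p caratheodory_superposition_measurable[OF g_car assms]])
    (rule g_bounded)

lemma kernel_bound:
  assumes t: "t \<in> {a..b}" and w: "w \<in> Lp_space p a b"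
  shows "\<bar>LINT s|lebesgue_on {a..b}. k t s * w s\<bar> \<le> M1 t * Lp_norm p a b w"
  using Hoelder_Lp(2)[OF p pq w k_Lq[OF t]] mult_right_mono[OF k_norm[OF t] Lp_norm_nonneg]
  by (rule order_trans)

lemma kernel_term_measurable:
  assumes u: "u \<in> borel_measurable (lebesgue_on {a..b})"
  shows "kernel_term u \<in> borel_measurable (lebesgue_on {a..b})"
  unfolding kernel_term_def
  using k_Lq by (intro kernel_integral_measurable_on k_meas
      caratheodory_superposition_measurable[OF g_car u]) (simp add: Lp_space_def)

text \<open>
  Because \<open>g\<close> is bounded, \<open>g(\<cdot>, u)\<close> lies in \<open>L\<^sup>p\<close> for every measurable \<open>u\<close>, integrable or not. Hence
  \<open>\<bar>T u (t)\<bar> \<le> \<bar>f(t,0)\<bar> + M \<parallel>g(\<cdot>, u)\<parallel>\<^sub>p M\<^sub>1(t)\<close>, which is in \<open>L\<^sup>p\<close>. Assuming only measurability is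
  what later puts the pointwise limit of the iterates into \<open>L\<^sup>p\<close>.
\<close>

lemma T_in_Lp:
  assumes u: "u \<in> borel_measurable (lebesgue_on {a..b})"
  shows "T u \<in> Lp_space p a b"
proof -
  let ?c = "M * Lp_norm p a b (\<lambda>s. g s (u s))"
  have bound: "\<bar>T u t\<bar> \<le> \<bar>f t 0\<bar> + ?c * M1 t" if t: "t \<in> {a..b}" for t
  proof -
    have "\<bar>T u t\<bar> \<le> \<bar>f t 0\<bar> + M * \<bar>kernel_term u t\<bar>"
      using f_Lipschitz[OF t, of "kernel_term u t" 0] by (simp add: T_eq)
    also have "\<dots> \<le> \<bar>f t 0\<bar> + M * (M1 t * Lp_norm p a b (\<lambda>s. g s (u s)))"
      unfolding kernel_term_def
      by (intro add_left_mono mult_left_mono M_nonneg kernel_bound t g_superposition_Lp u)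
    finally show ?thesis by (simp add: mult_ac)
  qed
  show ?thesis
  proof (rule Lp_space_dominated[OF p])
    show "T u \<in> borel_measurable (lebesgue_on {a..b})"
      using caratheodory_superposition_measurable[OF f_car kernel_term_measurable[OF u]]
      by (simp add: T_eq[abs_def])
    show "(\<lambda>t. \<bar>f t 0\<bar> + ?c * M1 t) \<in> Lp_space p a b"
      by (intro Lp_space_add p Lp_space_abs Lp_space_cmult f_0 M1_Lp)
    show "AE t in lebesgue_on {a..b}. \<bar>T u t\<bar> \<le> \<bar>\<bar>f t 0\<bar> + ?c * M1 t\<bar>"
      using bound by (intro AE_I2) (simp add: order.trans[OF _ abs_ge_self])
  qed
qed

text \<open>
  The Lipschitz bound on \<open>f\<close> leaves the integral of \<open>k(t,s) (g(s,u(s)) - g(s,v(s)))\<close>, which Hoelder's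
  inequality bounds by \<open>M\<^sub>1(t)\<close> times a norm that is at most \<open>L \<parallel>u - v\<parallel>\<^sub>p\<close>.
\<close>

lemma T_diff_pointwise:
  assumes u: "u \<in> Lp_space p a b" and v: "v \<in> Lp_space p a b" and t: "t \<in> {a..b}"
  shows "\<bar>T u t - T v t\<bar> \<le> M * L * M1 t * Lp_norm p a b (\<lambda>s. u s - v s)"
proof -
  have um: "u \<in> borel_measurable (lebesgue_on {a..b})"
    and vm: "v \<in> borel_measurable (lebesgue_on {a..b})"
    using u v by (auto simp: Lp_space_def)
  note gu = g_superposition_Lp[OF um] and gv = g_superposition_Lp[OF vm]
  note gd = Lp_space_diff[OF p gu gv]
  have "Lp_norm p a b (\<lambda>s. g s (u s) - g s (v s)) \<le> Lp_norm p a b (\<lambda>s. L * (u s - v s))"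
  proof (rule Lp_norm_mono_AE[OF p])
    show "(\<lambda>s. g s (u s) - g s (v s)) \<in> borel_measurable (lebesgue_on {a..b})"
      using gd by (simp add: Lp_space_def)
    show "(\<lambda>s. L * (u s - v s)) \<in> Lp_space p a b"
      by (intro Lp_space_cmult Lp_space_diff p u v)
    show "AE s in lebesgue_on {a..b}. \<bar>g s (u s) - g s (v s)\<bar> \<le> \<bar>L * (u s - v s)\<bar>"
      using g_Lipschitz L_nonneg by (intro AE_I2) (simp add: abs_mult)
  qed
  then have gn: "Lp_norm p a b (\<lambda>s. g s (u s) - g s (v s)) \<le> L * Lp_norm p a b (\<lambda>s. u s - v s)"
    using L_nonneg by (simp add: Lp_norm_cmult[OF p])
  have "\<bar>T u t - T v t\<bar> \<le> M * \<bar>kernel_term u t - kernel_term v t\<bar>"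
    unfolding T_eq by (rule f_Lipschitz[OF t])
  also have "kernel_term u t - kernel_term v t
      = (LINT s|lebesgue_on {a..b}. k t s * (g s (u s) - g s (v s)))"
    using Hoelder_Lp(1)[OF p pq gu k_Lq[OF t]] Hoelder_Lp(1)[OF p pq gv k_Lq[OF t]]
    by (simp add: kernel_term_def right_diff_distrib)
  also have "M * \<bar>LINT s|lebesgue_on {a..b}. k t s * (g s (u s) - g s (v s))\<bar>
      \<le> M * (M1 t * (L * Lp_norm p a b (\<lambda>s. u s - v s)))"
    by (intro mult_left_mono M_nonneg order_trans[OF kernel_bound[OF t gd]] gn M1_nonneg[OF t])
  finally show ?thesis by (simp add: mult_ac)
qed

text \<open>
  Turns a pointwise bound of the kind given by \<open>T_diff_pointwise\<close> into a norm bound. Stated for bounds holding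
  almost everywhere, because a solution satisfies the equation only almost everywhere.
\<close>

lemma Lp_norm_le_of_pointwise:
  assumes w: "w \<in> borel_measurable (lebesgue_on {a..b})" and d: "0 \<le> d"
    and le: "AE t in lebesgue_on {a..b}. \<bar>w t\<bar> \<le> M * L * M1 t * d"
  shows "Lp_norm p a b w \<le> contraction_factor * d"
proof -
  have "Lp_norm p a b w \<le> Lp_norm p a b (\<lambda>t. d * (M * L * M1 t))"
  proof (rule Lp_norm_mono_AE[OF p w])
    show "(\<lambda>t. d * (M * L * M1 t)) \<in> Lp_space p a b"
      by (intro Lp_space_cmult M1_Lp)
    show "AE t in lebesgue_on {a..b}. \<bar>w t\<bar> \<le> \<bar>d * (M * L * M1 t)\<bar>"
      using le by eventually_elim (simp add: mult_ac order.trans[OF _ abs_ge_self])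
  qed
  also have "\<dots> = contraction_factor * d"
    using d unfolding Lp_norm_cmult[OF p, of _ _ d] contraction_factor_def by simp
  finally show ?thesis .
qed

lemma T_contraction:
  assumes u: "u \<in> Lp_space p a b" and v: "v \<in> Lp_space p a b"
  shows "Lp_norm p a b (\<lambda>t. T u t - T v t)
    \<le> contraction_factor * Lp_norm p a b (\<lambda>t. u t - v t)"
proof (rule Lp_norm_le_of_pointwise)
  have "T u \<in> Lp_space p a b" "T v \<in> Lp_space p a b"
    by (intro T_in_Lp Lp_space_measurable[OF u] Lp_space_measurable[OF v])+
  then show "(\<lambda>t. T u t - T v t) \<in> borel_measurable (lebesgue_on {a..b})"
    by (auto simp: Lp_space_def)
  show "AE t in lebesgue_on {a..b}.
      \<bar>T u t - T v t\<bar> \<le> M * L * M1 t * Lp_norm p a b (\<lambda>t. u t - v t)"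
    using T_diff_pointwise[OF u v] by (intro AE_I2) simp
qed (rule Lp_norm_nonneg)

lemma solution_unique:
  assumes factor: "contraction_factor < 1"
    and u: "is_solution p a b f k g u" and v: "is_solution p a b f k g v"
  shows "AE t in lebesgue_on {a..b}. v t = u t"
proof -
  define d where "d = Lp_norm p a b (\<lambda>t. v t - u t)"
  have uL: "u \<in> Lp_space p a b" and vL: "v \<in> Lp_space p a b"
    using u v by (auto simp: is_solution_def)
  have diff: "(\<lambda>t. v t - u t) \<in> Lp_space p a b"
    by (rule Lp_space_diff[OF p vL uL])
  have "AE t in lebesgue_on {a..b}. t \<in> {a..b}"
    by (rule AE_I2) simp
  moreover have "AE t in lebesgue_on {a..b}. u t = T u t" "AE t in lebesgue_on {a..b}. v t = T v t"
    using u v by (auto simp: is_solution_def)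
  ultimately have "AE t in lebesgue_on {a..b}. \<bar>v t - u t\<bar> \<le> M * L * M1 t * d"
    by eventually_elim (metis T_diff_pointwise[OF vL uL] d_def)
  then have "d \<le> contraction_factor * d"
    using diff unfolding d_def
    by (intro Lp_norm_le_of_pointwise Lp_norm_nonneg) (simp_all add: Lp_space_def)
  moreover have "0 \<le> d"
    by (simp add: d_def Lp_norm_nonneg)
  moreover have "contraction_factor * d < 1 * d" if "0 < d"
    by (rule mult_strict_right_mono[OF factor that])
  ultimately have "d = 0"
    by fastforce
  then show ?thesis
    using Lp_norm_eq_0_imp_AE[OF diff] by (simp add: d_def)
qed

section \<open>Convergence of the successive approximations\<close>

lemma iterates_in_Lp:
  assumes y_0: "y 0 \<in> Lp_space p a b"
    and y_Suc: "\<And>n t. t \<in> {a..b} \<Longrightarrow> y (Suc n) t = T (y n) t"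
  shows "y n \<in> Lp_space p a b"
proof (induction n)
  case (Suc n)
  then have "T (y n) \<in> Lp_space p a b"
    by (intro T_in_Lp) (simp add: Lp_space_def)
  then show ?case
    by (rule Lp_space_cong[THEN iffD2, rotated]) (rule y_Suc)
qed (rule y_0)

lemma iterates_increment_norm:
  assumes y_0: "y 0 \<in> Lp_space p a b"
    and y_Suc: "\<And>n t. t \<in> {a..b} \<Longrightarrow> y (Suc n) t = T (y n) t"
  shows "Lp_norm p a b (\<lambda>t. y (Suc n) t - y n t)
    \<le> contraction_factor ^ n * Lp_norm p a b (\<lambda>t. y 1 t - y 0 t)"
proof (induction n)
  case (Suc n)
  note y_Lp = iterates_in_Lp[OF assms]
  have "Lp_norm p a b (\<lambda>t. y (Suc (Suc n)) t - y (Suc n) t)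
      = Lp_norm p a b (\<lambda>t. T (y (Suc n)) t - T (y n) t)"
    by (rule Lp_norm_cong) (simp add: y_Suc)
  also have "\<dots> \<le> contraction_factor * Lp_norm p a b (\<lambda>t. y (Suc n) t - y n t)"
    by (rule T_contraction[OF y_Lp y_Lp])
  also have "\<dots> \<le> contraction_factor
      * (contraction_factor ^ n * Lp_norm p a b (\<lambda>t. y 1 t - y 0 t))"
    by (rule mult_left_mono[OF Suc.IH]) (simp add: contraction_factor_def Lp_norm_nonneg)
  finally show ?case by (simp add: mult_ac)
qed simp

text \<open>
  The increments decay geometrically at each fixed \<open>t\<close>: the decay of their norms enters the pointwise estimate
  as the last factor.
\<close>

lemma iterates_convergent:
  assumes factor: "contraction_factor < 1"
    and y_0: "y 0 \<in> Lp_space p a b"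
    and y_Suc: "\<And>n t. t \<in> {a..b} \<Longrightarrow> y (Suc n) t = T (y n) t"
    and t: "t \<in> {a..b}"
  shows "convergent (\<lambda>n. y n t)"
proof -
  let ?D = "Lp_norm p a b (\<lambda>t. y 1 t - y 0 t)"
  have "summable (\<lambda>n. M * L * M1 t * ?D * contraction_factor ^ n)"
    using factor by (intro summable_mult summable_geometric)
      (simp add: contraction_factor_def Lp_norm_nonneg)
  \<comment> \<open>The first increment \<open>y 1 - y 0\<close> is left out: \<open>y 0\<close> is not the image of an iterate under \<open>T\<close>,
      so the pointwise estimate applies from \<open>y 2 - y 1\<close> on.\<close>
  moreover have "norm (y (Suc (Suc n)) t - y (Suc n) t) \<le> M * L * M1 t * ?D * contraction_factor ^ n"
    for n
  proof -
    note y_Lp = iterates_in_Lp[OF y_0 y_Suc]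
    have "\<bar>y (Suc (Suc n)) t - y (Suc n) t\<bar>
        \<le> M * L * M1 t * Lp_norm p a b (\<lambda>s. y (Suc n) s - y n s)"
      using T_diff_pointwise[OF y_Lp y_Lp t] by (simp add: y_Suc[OF t])
    also have "\<dots> \<le> M * L * M1 t * (contraction_factor ^ n * ?D)"
      by (intro mult_left_mono iterates_increment_norm[OF y_0 y_Suc] mult_nonneg_nonneg
          M_nonneg L_nonneg M1_nonneg t)
    finally show ?thesis by (simp add: mult_ac)
  qed
  ultimately have "summable (\<lambda>n. y (Suc (Suc n)) t - y (Suc n) t)"
    by (rule summable_comparison_test'[where N = 0])
  then have "convergent (\<lambda>n. \<Sum>i<n. y (Suc (Suc i)) t - y (Suc i) t)"
    by (simp add: summable_iff_convergent)
  then have "convergent (\<lambda>n. y (Suc n) t - y 1 t)"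
    by (simp add: sum_lessThan_telescope[of "\<lambda>i. y (Suc i) t"])
  then have "convergent (\<lambda>n. y (Suc n) t)"
    using convergent_add[OF _ convergent_const[of "y 1 t"]] by fastforce
  then show ?thesis
    by (rule convergent_Suc_iff[THEN iffD1])
qed

text \<open>
  Dominated convergence applies at each fixed \<open>t\<close> with dominating function \<open>B \<bar>k(t,\<cdot>)\<bar>\<close>, which is integrable
  since \<open>L\<^sup>q([a,b]) \<subseteq> L\<^sup>1([a,b])\<close>.
\<close>

lemma limit_is_fixed_point:
  assumes y_Lp: "\<And>n. y n \<in> Lp_space p a b"
    and y_Suc: "\<And>n t. t \<in> {a..b} \<Longrightarrow> y (Suc n) t = T (y n) t"
    and lim: "\<And>t. t \<in> {a..b} \<Longrightarrow> (\<lambda>n. y n t) \<longlonglongrightarrow> u t"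
    and u [measurable]: "u \<in> borel_measurable (lebesgue_on {a..b})"
    and t: "t \<in> {a..b}"
  shows "u t = T u t"
proof -
  have y_meas: "y n \<in> borel_measurable (lebesgue_on {a..b})" for n
    using y_Lp by (rule Lp_space_measurable)
  have one: "(\<lambda>s. 1) \<in> Lp_space p a b"
    by (rule Lp_space_bounded[OF p, of _ _ _ 1]) auto
  have k_int: "integrable (lebesgue_on {a..b}) (k t)"
    using Hoelder_Lp(1)[OF p pq one k_Lq[OF t]] by simp
  have "(\<lambda>n. kernel_term (y n) t) \<longlonglongrightarrow> kernel_term u t"
    unfolding kernel_term_def
  proof (rule integral_dominated_convergence[where w = "\<lambda>s. B * \<bar>k t s\<bar>"])
    show "(\<lambda>s. k t s * g s (u s)) \<in> borel_measurable (lebesgue_on {a..b})"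
      "(\<lambda>s. k t s * g s (y n s)) \<in> borel_measurable (lebesgue_on {a..b})" for n
      using k_int caratheodory_superposition_measurable[OF g_car] u y_meas
      by (auto intro!: borel_measurable_times)
    show "integrable (lebesgue_on {a..b}) (\<lambda>s. B * \<bar>k t s\<bar>)"
      using k_int by simp
    show "AE s in lebesgue_on {a..b}. (\<lambda>n. k t s * g s (y n s)) \<longlonglongrightarrow> k t s * g s (u s)"
    proof (rule AE_I2)
      fix s assume "s \<in> space (lebesgue_on {a..b})"
      then have s: "s \<in> {a..b}" by simp
      then have "isCont (g s) (u s)"
        using g_car by (auto simp: caratheodory_def continuous_on_eq_continuous_at)
      then show "(\<lambda>n. k t s * g s (y n s)) \<longlonglongrightarrow> k t s * g s (u s)"
        by (intro tendsto_mult tendsto_const isCont_tendsto_compose[OF _ lim[OF s]])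
    qed
    show "AE s in lebesgue_on {a..b}. norm (k t s * g s (y n s)) \<le> B * \<bar>k t s\<bar>" for n
    proof (rule AE_I2)
      fix s assume "s \<in> space (lebesgue_on {a..b})"
      then have "\<bar>g s (y n s)\<bar> * \<bar>k t s\<bar> \<le> B * \<bar>k t s\<bar>"
        by (intro mult_right_mono g_bounded) auto
      then show "norm (k t s * g s (y n s)) \<le> B * \<bar>k t s\<bar>"
        by (simp add: abs_mult mult.commute)
    qed
  qed
  moreover have "isCont (f t) (kernel_term u t)"
    using f_car t by (auto simp: caratheodory_def continuous_on_eq_continuous_at)
  ultimately have "(\<lambda>n. f t (kernel_term (y n) t)) \<longlonglongrightarrow> f t (kernel_term u t)"
    by (rule isCont_tendsto_compose[rotated])
  then have "(\<lambda>n. y (Suc n) t) \<longlonglongrightarrow> T u t"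
    by (simp add: y_Suc[OF t] T_eq)
  moreover have "(\<lambda>n. y (Suc n) t) \<longlonglongrightarrow> u t"
    using lim[OF t] by (rule LIMSEQ_Suc)
  ultimately show ?thesis
    using LIMSEQ_unique by blast
qed

lemma iterates_converge_to_solution:
  assumes factor: "contraction_factor < 1"
    and y_0: "y 0 \<in> Lp_space p a b"
    and y_Suc: "\<And>n t. t \<in> {a..b} \<Longrightarrow> y (Suc n) t = T (y n) t"
  obtains u where "is_solution p a b f k g u" "\<And>t. t \<in> {a..b} \<Longrightarrow> (\<lambda>n. y n t) \<longlonglongrightarrow> u t"
proof -
  define u where "u t = lim (\<lambda>n. y n t)" for t
  have lim: "(\<lambda>n. y n t) \<longlonglongrightarrow> u t" if "t \<in> {a..b}" for t
    using iterates_convergent[OF assms that] by (simp add: u_def convergent_LIMSEQ_iff)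
  note y_Lp = iterates_in_Lp[OF y_0 y_Suc]
  have u: "u \<in> borel_measurable (lebesgue_on {a..b})"
  proof (rule borel_measurable_LIMSEQ_real)
    show "(\<lambda>n. y n t) \<longlonglongrightarrow> u t" if "t \<in> space (lebesgue_on {a..b})" for t
      using that by (intro lim) simp
    show "y n \<in> borel_measurable (lebesgue_on {a..b})" for n
      using y_Lp by (rule Lp_space_measurable)
  qed
  have fixed: "u t = T u t" if "t \<in> {a..b}" for t
    by (rule limit_is_fixed_point[OF y_Lp y_Suc lim u that])
  have "u \<in> Lp_space p a b"
    using T_in_Lp[OF u] by (rule Lp_space_cong[THEN iffD2, rotated]) (rule fixed)
  then have "is_solution p a b f k g u"
    using fixed by (auto simp: is_solution_def intro: AE_I2)
  then show ?thesis
    using lim that by blast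
qed

end

theorem theorem2p2:
  fixes a b p q b1 b0 M L C :: real
    and f k g :: "real \<Rightarrow> real \<Rightarrow> real"
    and h1 M1 a0 :: "real \<Rightarrow> real"
    and y :: "nat \<Rightarrow> real \<Rightarrow> real"
  assumes ab: "a < b"
    and p: "1 < p"
    and pq: "1 / p + 1 / q = 1"
    and f_car: "caratheodory a b f"
    and k_meas: "(\<lambda>(t, s). k t s) \<in> borel_measurable (lebesgue_on ({a..b} \<times> {a..b}))"
    and A1_h1: "h1 \<in> Lp_space p a b" "\<And>t. t \<in> {a..b} \<Longrightarrow> 0 \<le> h1 t"
    and A1_b1: "0 \<le> b1"
    and A1: "AE t in lebesgue_on {a..b}. \<forall>x. \<bar>f t x\<bar> \<le> h1 t + b1 * \<bar>x\<bar> powr (q / p)"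
    and A2_k: "\<And>t. t \<in> {a..b} \<Longrightarrow> (\<lambda>s. k t s) \<in> Lp_space q a b"
    and A2_M1: "M1 \<in> Lp_space p a b" "\<And>t. t \<in> {a..b} \<Longrightarrow> 0 \<le> M1 t"
    and A2: "\<And>t. t \<in> {a..b} \<Longrightarrow>
               (LINT s|lebesgue_on {a..b}. \<bar>k t s\<bar> powr q) powr (1 / q) \<le> M1 t"
    and A3_range: "\<And>s z. s \<in> {a..b} \<Longrightarrow> g s z \<in> {a..b}"
    and A3_car: "caratheodory a b g"
    and A3_a0: "a0 \<in> Lp_space p a b" "\<And>s. s \<in> {a..b} \<Longrightarrow> 0 \<le> a0 s"
    and A3_b0: "0 \<le> b0"
    and A3: "\<And>s z. s \<in> {a..b} \<Longrightarrow> \<bar>g s z\<bar> \<le> a0 s + b0 * \<bar>z\<bar>"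
    and H1_M: "0 < M"
    and H1: "\<And>t x1 x2. t \<in> {a..b} \<Longrightarrow> \<bar>f t x1 - f t x2\<bar> \<le> M * \<bar>x1 - x2\<bar>"
    and H2_L: "0 < L"
    and H2: "\<And>s z1 z2. s \<in> {a..b} \<Longrightarrow> \<bar>g s z1 - g s z2\<bar> \<le> L * \<bar>z1 - z2\<bar>"
    and C: "C = M * L"
    and y_0: "\<And>t. t \<in> {a..b} \<Longrightarrow> y 0 t = 0"
    and y_Suc: "\<And>n t. t \<in> {a..b} \<Longrightarrow> y (Suc n) t = rhs_operator a b f k g (y n) t"
    and N: "(LINT s|lebesgue_on {a..b}. C powr p * M1 s powr p) < 1"
  shows "\<exists>u. is_solution p a b f k g u \<and>
             (\<forall>v. is_solution p a b f k g v \<longrightarrow> (AE t in lebesgue_on {a..b}. v t = u t)) \<and>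
             (AE t in lebesgue_on {a..b}. (\<lambda>n. y n t) \<longlonglongrightarrow> u t)"
proof -
  have f_car': "(\<lambda>t. f t 0) \<in> borel_measurable (lebesgue_on {a..b})"
    using f_car by (simp add: caratheodory_def)
  \<comment> \<open>At \<open>x = 0\<close> the growth bound on \<open>f\<close> reads \<open>\<bar>f t 0\<bar> \<le> h1 t\<close>, since \<open>0 powr (q / p) = 0\<close>.\<close>
  have f_0: "(\<lambda>t. f t 0) \<in> Lp_space p a b"
  proof (rule Lp_space_dominated[OF p f_car' A1_h1(1)])
    show "AE t in lebesgue_on {a..b}. \<bar>f t 0\<bar> \<le> \<bar>h1 t\<bar>"
      using A1
    proof eventually_elim
      case (elim t)
      then have "\<bar>f t 0\<bar> \<le> h1 t + b1 * \<bar>0\<bar> powr (q / p)" by blast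
      then show ?case by simp
    qed
  qed
  interpret Lipschitz_integral_equation a b p q "max \<bar>a\<bar> \<bar>b\<bar>" M L f k g M1
  proof
    show "\<bar>g s z\<bar> \<le> max \<bar>a\<bar> \<bar>b\<bar>" if "s \<in> {a..b}" for s z
      using A3_range[OF that, of z] by auto
    show "Lp_norm q a b (k t) \<le> M1 t" if "t \<in> {a..b}" for t
      using A2[OF that] by (simp add: Lp_norm_def)
  qed (fact p pq f_car f_0 H1 less_imp_le[OF H1_M] k_meas A2_k A2_M1 A3_car H2 less_imp_le[OF H2_L])+
  have "(LINT s|lebesgue_on {a..b}. \<bar>M * L * M1 s\<bar> powr p)
      = (LINT s|lebesgue_on {a..b}. C powr p * M1 s powr p)"
    using A2_M1(2) H1_M H2_L
    by (intro Bochner_Integration.integral_cong) (auto simp: C abs_mult powr_mult)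
  then have "contraction_factor powr p < 1"
    using N p by (simp add: contraction_factor_def Lp_norm_def powr_powr)
  then have factor: "contraction_factor < 1"
    using p ge_one_powr_ge_zero[of contraction_factor p] by linarith
  have "(\<lambda>t. 0) \<in> Lp_space p a b"
    by (rule Lp_space_bounded[OF p, of _ _ _ 0]) auto
  then have y0_Lp: "y 0 \<in> Lp_space p a b"
    by (rule Lp_space_cong[THEN iffD2, rotated]) (rule y_0)
  obtain u where u: "is_solution p a b f k g u"
    and lim: "\<And>t. t \<in> {a..b} \<Longrightarrow> (\<lambda>n. y n t) \<longlonglongrightarrow> u t"
    using iterates_converge_to_solution[OF factor y0_Lp y_Suc] by blast
  show ?thesis
  proof (intro exI conjI allI impI)
    show "is_solution p a b f k g u" by (rule u)
    show "AE t in lebesgue_on {a..b}. v t = u t" if "is_solution p a b f k g v" for v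
      by (rule solution_unique[OF factor u that])
    show "AE t in lebesgue_on {a..b}. (\<lambda>n. y n t) \<longlonglongrightarrow> u t"
      using lim by (intro AE_I2) simp
  qed
qed

end
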